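(* Let $G$ and $H$ be finite groups. (a) $\mathrm{os}(G\times H)=\mathrm{os}(G)\vee\mathrm{os}(H)$. In particular, $\mathrm{os}(G\times H)=\mathrm{os}(G)\,\mathrm{os}(H)$ if and only if $|G|$ and $|H|$ are coprime. (b) Assume that $\gcd(|G|,|H|)=1$. Given $\mathrm{os}(G\times H)$ and the numbers $|G|$ and $|H|$, the sequences $\mathrm{os}(G)$ and $\mathrm{os}(H)$ are determined. (c) If $|G|$ and $|H|$ are not coprime, then there is no finite group $K$ for which $\mathrm{os}(G)\,\mathrm{os}(H)=\mathrm{os}(K)$.
   Context: For a finite group $G$ of order $n$, the order sequence $\mathrm{os}(G)=(o(g_1),\dots,o(g_n))$ is the list of orders of all elements of $G$ arranged in non-decreasing order, where $o(g)$ denotes the order of $g$. For non-decreasing sequences $x=(x_1,\dots,x_m)$ and $y=(y_1,\dots,y_n)$ of positive integers, $xy$ is the sequence of length $mn$ obtained by taking all products $x_iy_j$ ($1\le i\le m$, $1\le j\le n$) and writing them in non-decreasing order; $x\vee y$ is the sequence of length $mn$ obtained by taking all numbers $\mathrm{lcm}\{x_i,y_j\}$ ($1\le i\le m$, $1\le j\le n$) and writing them in non-decreasing order. $\mathrm{os}(G)\,\mathrm{os}(H)$ denotes the product in this sense. *)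

theory Defs
  imports "HOL-Algebra.Multiplicative_Group" "HOL-Library.Multiset"
begin

definition order_seq :: "('a, 'm) monoid_scheme \<Rightarrow> nat list" where
  "order_seq G = sorted_list_of_multiset (image_mset (group.ord G) (mset_set (carrier G)))"

definition seq_prod :: "nat list \<Rightarrow> nat list \<Rightarrow> nat list" where
  "seq_prod xs ys = sort (map (\<lambda>(x, y). x * y) (List.product xs ys))"

definition seq_lcm :: "nat list \<Rightarrow> nat list \<Rightarrow> nat list" where
  "seq_lcm xs ys = sort (map (\<lambda>(x, y). lcm x y) (List.product xs ys))"

end

theory Submission
  imports Defs "HOL-Algebra.Sylow" "HOL-Number_Theory.Cong"
begin

text \<open>
  A sorted list is determined by its multiset of entries, so every claim is about the numbers of
  elements of each order. In \<open>G \<times>\<times> H\<close> the power \<open>(x, y)\<^sup>n\<close> is trivial iff both orders divide \<open>n\<close>,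
  hence \<open>(x, y)\<close> has order \<open>lcm (ord x) (ord y)\<close> (\<open>ord_DirProd\<close>). If the group orders are coprime,
  so are \<open>ord x\<close> and \<open>ord y\<close>, and the lcm is the product.

  In the coprime case, when \<open>d\<close> divides \<open>|G|\<close> the elements of order \<open>d\<close> in \<open>G \<times>\<times> H\<close> are exactly the
  \<open>(x, \<one>)\<close> with \<open>ord x = d\<close>. The counts for \<open>G\<close>, and symmetrically for \<open>H\<close>, can therefore be read
  off from those of the direct product (\<open>count_order_seq_DirProd_coprime\<close>).

  Now let a prime \<open>p\<close> divide both group orders. In every finite group whose order is divisible by
  \<open>p\<close>, the number of elements of order \<open>p\<close> is congruent to \<open>-1\<close> modulo \<open>p\<close>
  (\<open>prime_dvd_Suc_card_ord\<close>). A product of two numbers equals \<open>p\<close> only as \<open>p * 1\<close> or \<open>1 * p\<close>, so \<open>p\<close>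
  occurs in the product of the order sequences as often as in both factors together, that is,
  congruent to \<open>-2\<close>. A group \<open>K\<close> with this order sequence would have order \<open>|G| |H|\<close>, so the count
  would also be \<open>-1\<close> modulo \<open>p\<close>, which is impossible (\<open>seq_prod_not_order_seq\<close>). Applied to
  \<open>K = G \<times>\<times> H\<close>, this also shows that \<open>os(G \<times>\<times> H) = os(G) os(H)\<close> forces coprimality.

  The congruence is proved by counting the solutions of \<open>x\<^sup>p = \<one>\<close> up to multiples of \<open>p\<close>, using two
  maps of period \<open>p\<close> built from an element \<open>u\<close> of order \<open>p\<close>: conjugation by \<open>u\<close> discards the
  solutions that do not commute with \<open>u\<close>, and multiplication by \<open>u\<close> moves all the others.
\<close>

section \<open>Order sequences as multisets\<close>

lemma mset_order_seq:
  "mset (order_seq G) = image_mset (group.ord G) (mset_set (carrier G))"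
  by (simp add: order_seq_def)

lemma length_order_seq: "length (order_seq G) = order G"
  by (metis mset_order_seq order_def size_image_mset size_mset size_mset_set)

lemma count_image_mset_set:
  assumes "finite A"
  shows "count (image_mset f (mset_set A)) y = card {x \<in> A. f x = y}"
proof -
  have "count (image_mset f (mset_set A)) y = (\<Sum>x\<in>{x \<in> A. f x = y}. 1)"
    unfolding count_image_mset' using assms by (intro sum.cong) auto
  then show ?thesis by simp
qed

lemma count_order_seq:
  assumes "finite (carrier G)"
  shows "count (mset (order_seq G)) d = card {x \<in> carrier G. group.ord G x = d}"
  unfolding mset_order_seq using assms by (rule count_image_mset_set)

lemma order_seq_eq_iff: "order_seq G = order_seq H \<longleftrightarrow> mset (order_seq G) = mset (order_seq H)"
  by (metis order_seq_def mset_sorted_list_of_multiset)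

lemma order_seq_eq_sort_iff: "order_seq G = sort zs \<longleftrightarrow> mset (order_seq G) = mset zs"
  by (metis order_seq_def sorted_list_of_multiset_mset mset_sorted_list_of_multiset mset_sort)

lemma count_product:
  "count (mset (List.product xs ys)) (x, y) = count (mset xs) x * count (mset ys) y"
proof (induction xs)
  case (Cons a xs)
  have "count (mset (map (Pair a) ys)) (x, y) = (if a = x then count (mset ys) y else 0)"
    by (induction ys) auto
  then show ?case using Cons by auto
qed simp

text \<open>
  Both operations on order sequences map a binary function over all pairs of entries; here such a
  list of values is indexed by the pairs of group elements instead, the index set of the order
  sequence of the direct product.
\<close>

lemma mset_map_product_order_seq:
  assumes "finite (carrier G)" "finite (carrier H)"
  shows "mset (map f (List.product (order_seq G) (order_seq H))) =
    image_mset (\<lambda>(x, y). f (group.ord G x, group.ord H y)) (mset_set (carrier G \<times> carrier H))"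
proof -
  have "mset (List.product (order_seq G) (order_seq H)) =
    image_mset (\<lambda>(x, y). (group.ord G x, group.ord H y)) (mset_set (carrier G \<times> carrier H))"
  proof (rule multiset_eqI)
    fix de :: "nat \<times> nat"
    obtain d e where de: "de = (d, e)" by fastforce
    have "{z \<in> carrier G \<times> carrier H. (case z of (x, y) \<Rightarrow> (group.ord G x, group.ord H y)) = (d, e)}
      = {x \<in> carrier G. group.ord G x = d} \<times> {y \<in> carrier H. group.ord H y = e}"
      by auto
    then show "count (mset (List.product (order_seq G) (order_seq H))) de = count
      (image_mset (\<lambda>(x, y). (group.ord G x, group.ord H y)) (mset_set (carrier G \<times> carrier H))) de"
      using assms unfolding de count_product
      by (simp add: count_order_seq count_image_mset_set card_cartesian_product)
  qed
  then show ?thesis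
    by (simp add: multiset.map_comp comp_def case_prod_unfold)
qed

section \<open>Direct products\<close>

lemma DirProd_pow:
  "(x, y) [^]\<^bsub>G \<times>\<times> H\<^esub> (n::nat) = (x [^]\<^bsub>G\<^esub> n, y [^]\<^bsub>H\<^esub> n)"
  by (induction n) (simp_all add: nat_pow_def)

lemma ord_DirProd:
  assumes G: "group G" and H: "group H" and "x \<in> carrier G" "y \<in> carrier H"
  shows "group.ord (G \<times>\<times> H) (x, y) = lcm (group.ord G x) (group.ord H y)"
  using assms
  by (simp add: group.ord_unique[OF DirProd_group] DirProd_pow group.pow_eq_id lcm_least_iff)

lemma order_seq_DirProd:
  assumes "group G" "finite (carrier G)" "group H" "finite (carrier H)"
  shows "order_seq (G \<times>\<times> H) = seq_lcm (order_seq G) (order_seq H)"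
  unfolding seq_lcm_def order_seq_eq_sort_iff mset_order_seq mset_map_product_order_seq[OF assms(2,4)]
  using assms by (auto intro!: image_mset_cong simp: ord_DirProd)

lemma order_seq_DirProd_coprime:
  assumes "group G" "finite (carrier G)" "group H" "finite (carrier H)"
    and "coprime (order G) (order H)"
  shows "order_seq (G \<times>\<times> H) = seq_prod (order_seq G) (order_seq H)"
proof -
  have "lcm (group.ord G x) (group.ord H y) = group.ord G x * group.ord H y"
    if "x \<in> carrier G" "y \<in> carrier H" for x y
  proof -
    have "coprime (group.ord G x) (group.ord H y)"
      using that assms group.ord_dvd_group_order coprime_divisors by metis
    then show ?thesis by (simp add: lcm_coprime)
  qed
  then show ?thesis
    unfolding seq_prod_def order_seq_eq_sort_iff mset_order_seq mset_map_product_order_seq[OF assms(2,4)]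
    using assms by (auto intro!: image_mset_cong simp: ord_DirProd)
qed

text \<open>
  If the lcm divides \<open>m\<close>, then \<open>b\<close> divides both \<open>m\<close> and \<open>n\<close>. This is what singles out the first
  factor inside a direct product of groups of coprime orders \<open>m\<close> and \<open>n\<close>.
\<close>

lemma lcm_eq_iff_coprime_bounds:
  fixes a b m n d :: nat
  assumes "coprime m n" "a dvd m" "b dvd n" "d dvd m"
  shows "lcm a b = d \<longleftrightarrow> a = d \<and> b = 1"
proof
  assume eq: "lcm a b = d"
  then have "b dvd m" using assms(4) by (metis dvd_lcm2 dvd_trans)
  then have "b = 1" using assms by (metis coprime_common_divisor_nat)
  then show "a = d \<and> b = 1" using eq by simp
qed simp

lemma count_order_seq_DirProd_coprime:
  assumes G: "group G" "finite (carrier G)" and H: "group H" "finite (carrier H)"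
    and cop: "coprime (order G) (order H)"
  shows "count (mset (order_seq G)) d =
    (if d dvd order G then count (mset (order_seq (G \<times>\<times> H))) d else 0)"
    and "count (mset (order_seq H)) d =
    (if d dvd order H then count (mset (order_seq (G \<times>\<times> H))) d else 0)"
proof -
  interpret G: group G by fact
  interpret H: group H by fact
  have "group.ord (G \<times>\<times> H) (x, y) = d \<longleftrightarrow> G.ord x = d \<and> y = \<one>\<^bsub>H\<^esub>"
    if "d dvd order G" "x \<in> carrier G" "y \<in> carrier H" for x y
    using that lcm_eq_iff_coprime_bounds[OF cop G.ord_dvd_group_order H.ord_dvd_group_order]
    by (simp add: ord_DirProd G(1) H(1) H.ord_eq_1[simplified])
  then have "{z \<in> carrier G \<times> carrier H. group.ord (G \<times>\<times> H) z = d}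
      = {x \<in> carrier G. G.ord x = d} \<times> {\<one>\<^bsub>H\<^esub>}" if "d dvd order G"
    using that by auto
  then show "count (mset (order_seq G)) d =
    (if d dvd order G then count (mset (order_seq (G \<times>\<times> H))) d else 0)"
    using G.ord_dvd_group_order G H by (auto simp: count_order_seq)
  have "group.ord (G \<times>\<times> H) (x, y) = d \<longleftrightarrow> H.ord y = d \<and> x = \<one>\<^bsub>G\<^esub>"
    if "d dvd order H" "x \<in> carrier G" "y \<in> carrier H" for x y
    using that lcm_eq_iff_coprime_bounds[OF _ H.ord_dvd_group_order G.ord_dvd_group_order] cop
    by (simp add: ord_DirProd G(1) H(1) G.ord_eq_1[simplified] lcm.commute coprime_commute)
  then have "{z \<in> carrier G \<times> carrier H. group.ord (G \<times>\<times> H) z = d}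
      = {\<one>\<^bsub>G\<^esub>} \<times> {y \<in> carrier H. H.ord y = d}" if "d dvd order H"
    using that by auto
  then show "count (mset (order_seq H)) d =
    (if d dvd order H then count (mset (order_seq (G \<times>\<times> H))) d else 0)"
    using H.ord_dvd_group_order G H by (auto simp: count_order_seq)
qed

text \<open>
  The counts in the preceding lemma depend only on the two orders and on the order sequence of the
  direct product.
\<close>

lemma order_seq_factors_determined:
  assumes G: "group G" "finite (carrier G)" and H: "group H" "finite (carrier H)"
    and G': "group G'" "finite (carrier G')" and H': "group H'" "finite (carrier H')"
    and ord: "order G' = order G" "order H' = order H"
    and cop: "coprime (order G) (order H)"
    and eq: "order_seq (G' \<times>\<times> H') = order_seq (G \<times>\<times> H)"
  shows "order_seq G' = order_seq G" "order_seq H' = order_seq H"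
proof -
  have "coprime (order G') (order H')" using ord cop by simp
  note counts = count_order_seq_DirProd_coprime[OF G H cop]
    count_order_seq_DirProd_coprime[OF G' H' this]
  show "order_seq G' = order_seq G"
    unfolding order_seq_eq_iff by (rule multiset_eqI) (simp only: counts ord eq)
  show "order_seq H' = order_seq H"
    unfolding order_seq_eq_iff by (rule multiset_eqI) (simp only: counts ord eq)
qed

section \<open>Elements of prime order\<close>

text \<open>
  The iterates of \<open>f\<close> act on \<open>S\<close> as a cyclic group of prime order \<open>p\<close>, so each orbit has one or
  \<open>p\<close> elements; the moved points are the union of the orbits of size \<open>p\<close>.
\<close>

lemma prime_dvd_card_moved:
  assumes p: "prime p" and "finite S"
    and closed: "\<And>x. x \<in> S \<Longrightarrow> f x \<in> S"
    and period: "\<And>x. x \<in> S \<Longrightarrow> (f ^^ p) x = x"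
  shows "p dvd card {x \<in> S. f x \<noteq> x}"
proof -
  define T where "T = {x \<in> S. f x \<noteq> x}"
  define orb where "orb x = (\<lambda>k. (f ^^ k) x) ` {..<p}" for x
  have p0: "p > 0" using p prime_gt_0_nat by blast
  have iter: "(f ^^ k) x \<in> S" if "x \<in> S" for x k
    using that by (induction k) (auto intro: closed)
  have in_orb: "(f ^^ k) x \<in> orb x" if "x \<in> S" for x k
    using funpow_mod_eq[OF period[OF that], of k] p0 unfolding orb_def
    by (metis image_eqI lessThan_iff mod_less_divisor)
  have return: "(f ^^ (p - k)) ((f ^^ k) x) = x" if "x \<in> S" "k < p" for x k
    using period[OF that(1)] that(2) by (metis funpow_add comp_apply le_add_diff_inverse2 less_imp_le)
  have moved: "(f ^^ k) x \<in> T" if x: "x \<in> T" and k: "k < p" for x k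
  proof -
    have xS: "x \<in> S" using x by (simp add: T_def)
    have "f x = x" if "f ((f ^^ k) x) = (f ^^ k) x"
    proof -
      have "f x = f ((f ^^ (p - k)) ((f ^^ k) x))" using return[OF xS k] by simp
      also have "\<dots> = (f ^^ (p - k)) (f ((f ^^ k) x))" by (rule funpow_swap1)
      also have "\<dots> = x" using that return[OF xS k] by simp
      finally show ?thesis .
    qed
    then show ?thesis using x iter[OF xS] by (auto simp: T_def)
  qed
  have orb_sub: "orb y \<subseteq> orb x" if x: "x \<in> S" and y: "y \<in> orb x" for x y
  proof
    fix z assume "z \<in> orb y"
    then obtain i j where "y = (f ^^ j) x" "z = (f ^^ i) y" using y unfolding orb_def by auto
    then have "z = (f ^^ (i + j)) x" by (simp add: funpow_add)
    then show "z \<in> orb x" using in_orb[OF x] by simp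
  qed
  have orb_eq: "orb y = orb x" if x: "x \<in> S" and y: "y \<in> orb x" for x y
  proof -
    obtain k where k: "k < p" "y = (f ^^ k) x" using y unfolding orb_def by auto
    then have "x \<in> orb y" using in_orb[of y "p - k"] return[OF x k(1)] iter[OF x] by simp
    then show ?thesis using orb_sub[OF x y] orb_sub[of y x] iter[OF x] k by blast
  qed
  \<comment> \<open>A coincidence among the first \<open>p\<close> iterates gives a period \<open>j - i\<close> prime to \<open>p\<close>; having both
    periods, \<open>x\<close> would be fixed, since \<open>1\<close> is a multiple of \<open>j - i\<close> modulo \<open>p\<close>.\<close>
  have card_orb: "card (orb x) = p" if x: "x \<in> T" for x
  proof -
    have xS: "x \<in> S" and nfix: "f x \<noteq> x" using x by (auto simp: T_def)
    have "(f ^^ i) x \<noteq> (f ^^ j) x" if "i < j" "j < p" for i j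
    proof
      assume eq: "(f ^^ i) x = (f ^^ j) x"
      have "(f ^^ (j - i)) x = (f ^^ (j - i)) ((f ^^ (p - i)) ((f ^^ i) x))"
        using return[OF xS] that by simp
      also have "\<dots> = (f ^^ (p - i)) ((f ^^ (j - i)) ((f ^^ i) x))"
        by (metis add.commute comp_apply funpow_add)
      also have "(f ^^ (j - i)) ((f ^^ i) x) = (f ^^ i) x"
        using eq that by (metis add.commute comp_apply funpow_add le_add_diff_inverse less_imp_le)
      finally have d: "(f ^^ (j - i)) x = x" using return[OF xS] that by simp
      have "coprime (j - i) p"
        using p that by (metis coprime_commute nat_dvd_not_less prime_imp_coprime zero_less_diff
            less_imp_diff_less)
      then obtain a where a: "[(j - i) * a = Suc 0] (mod p)"
        using cong_solve_coprime_nat by blast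
      have "(f ^^ ((j - i) * a)) x = x"
        using funpow_mod_eq[OF d, of "(j - i) * a"] by simp
      moreover have "((j - i) * a) mod p = 1"
        using a prime_gt_1_nat[OF p] by (simp add: cong_def)
      ultimately have "f x = x"
        using funpow_mod_eq[OF period[OF xS], of "(j - i) * a"] by simp
      with nfix show False ..
    qed
    then have "inj_on (\<lambda>k. (f ^^ k) x) {..<p}"
      by (intro inj_onI) (metis lessThan_iff linorder_neqE_nat)
    then show ?thesis by (simp add: orb_def card_image)
  qed
  have union: "\<Union> (orb ` T) = T"
  proof
    show "\<Union> (orb ` T) \<subseteq> T" using moved by (auto simp: orb_def)
    show "T \<subseteq> \<Union> (orb ` T)" using in_orb[of _ 0] by (auto simp: T_def)
  qed
  have finT: "finite T" using \<open>finite S\<close> by (simp add: T_def)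
  have "p * card (orb ` T) = card (\<Union> (orb ` T))"
  proof (rule card_partition)
    show "finite (orb ` T)" "finite (\<Union> (orb ` T))" using finT union by simp_all
    show "card c = p" if "c \<in> orb ` T" for c using that card_orb by auto
    show "c \<inter> c' = {}" if "c \<in> orb ` T" "c' \<in> orb ` T" "c \<noteq> c'" for c c'
    proof (rule ccontr)
      assume "c \<inter> c' \<noteq> {}"
      then obtain y where y: "y \<in> c" "y \<in> c'" by blast
      obtain x x' where x: "x \<in> S" "c = orb x" and x': "x' \<in> S" "c' = orb x'"
        using \<open>c \<in> orb ` T\<close> \<open>c' \<in> orb ` T\<close> by (auto simp: T_def)
      have "c = orb y" using y(1) orb_eq[OF x(1)] unfolding x(2) by blast
      moreover have "c' = orb y" using y(2) orb_eq[OF x'(1)] unfolding x'(2) by blast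
      ultimately show False using \<open>c \<noteq> c'\<close> by blast
    qed
  qed
  then show ?thesis unfolding union T_def[symmetric] by (metis dvd_triv_left)
qed

context group
begin

text \<open>
  Cauchy's theorem. Sylow's theorem yields a subgroup of order \<open>p\<^sup>a\<close> for every \<open>p\<^sup>a\<close> dividing the
  group order, so \<open>a = 1\<close> is available, and any nontrivial element of that subgroup has order \<open>p\<close>.
\<close>

lemma exists_ord_prime:
  assumes "finite (carrier G)" "prime p" "p dvd order G"
  obtains u where "u \<in> carrier G" "ord u = p"
proof -
  obtain m where "order G = p ^ 1 * m" using assms(3) by auto
  then obtain P where P: "subgroup P G" "card P = p"
    using sylow_thm[OF assms(2) is_group _ assms(1), of 1 m] by auto
  have "P \<noteq> {\<one>}" using P(2) assms(2) by (auto simp: prime_gt_1_nat)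
  then obtain u where u: "u \<in> P" "u \<noteq> \<one>" using subgroup.one_closed[OF P(1)] by blast
  have uG: "u \<in> carrier G" by (rule subgroup.mem_carrier[OF P(1) u(1)])
  interpret P: group "G\<lparr>carrier := P\<rparr>" using P(1) by (simp add: subgroup.subgroup_is_group)
  have "u [^]\<^bsub>G\<lparr>carrier := P\<rparr>\<^esub> p = \<one>"
    using P.pow_order_eq_1[of u] u P(2) by (simp add: order_def)
  then have "u [^] p = \<one>" by (metis nat_pow_consistent)
  then have "ord u dvd p" using uG pow_eq_id by blast
  then have "ord u = p" using u(2) ord_eq_1[OF uG] assms(2) by (auto simp: prime_nat_iff)
  then show ?thesis using that uG by blast
qed

text \<open>
  Frobenius' theorem for a prime exponent. Let \<open>u\<close> have order \<open>p\<close>. Conjugation by \<open>u\<close> permutes the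
  solutions of \<open>x\<^sup>p = \<one>\<close> with period \<open>p\<close>, and its fixed points are the solutions that commute with
  \<open>u\<close>. Left multiplication by \<open>u\<close> preserves these, because commuting elements satisfy
  \<open>(u x)\<^sup>p = u\<^sup>p x\<^sup>p\<close>; it has period \<open>p\<close> and no fixed point.
\<close>

lemma prime_dvd_card_roots_of_one:
  assumes fin: "finite (carrier G)" and p: "prime p" and dvd: "p dvd order G"
  shows "p dvd card {x \<in> carrier G. x [^] p = \<one>}"
proof -
  obtain u where u: "u \<in> carrier G" and "ord u = p"
    using exists_ord_prime assms by blast
  then have up: "u [^] p = \<one>" and u1: "u \<noteq> \<one>"
    using pow_ord_eq_1[OF u] ord_eq_1[OF u] p by auto
  define S where "S = {x \<in> carrier G. x [^] p = \<one>}"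
  define C where "C = {x \<in> S. u \<otimes> x = x \<otimes> u}"
  let ?conj = "\<lambda>x. u \<otimes> x \<otimes> inv u"
  have finS: "finite S" using fin by (simp add: S_def)
  have l_inv_cancel: "inv u \<otimes> (u \<otimes> y) = y" if "y \<in> carrier G" for y
    using u that by (simp flip: m_assoc)
  have conj_pow: "(?conj x) [^] k = u \<otimes> x [^] k \<otimes> inv u" if "x \<in> carrier G" for x and k :: nat
  proof (induction k)
    case (Suc k)
    have "(?conj x) [^] Suc k = u \<otimes> x [^] k \<otimes> inv u \<otimes> (u \<otimes> x \<otimes> inv u)" using Suc by simp
    also have "\<dots> = u \<otimes> (x [^] k \<otimes> x) \<otimes> inv u"
      using u that by (simp add: m_assoc l_inv_cancel)
    finally show ?case by simp
  qed (use u in simp)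
  have conj_iter: "(?conj ^^ k) x = u [^] k \<otimes> x \<otimes> inv (u [^] k)" if "x \<in> carrier G" for x k
  proof (induction k)
    case (Suc k)
    have "u [^] Suc k = u \<otimes> u [^] k" using u nat_pow_Suc2 by blast
    then show ?case using Suc u that by (simp add: m_assoc inv_mult_group)
  qed (use that in simp)
  have "p dvd card {x \<in> S. ?conj x \<noteq> x}"
  proof (rule prime_dvd_card_moved[OF p finS])
    show "?conj x \<in> S" if "x \<in> S" for x using that u by (simp add: S_def conj_pow)
    show "(?conj ^^ p) x = x" if "x \<in> S" for x using that up by (simp add: S_def conj_iter)
  qed
  moreover have "{x \<in> S. ?conj x \<noteq> x} = S - C"
    using u by (auto simp: S_def C_def inv_solve_right')
  moreover have "p dvd card {x \<in> C. u \<otimes> x \<noteq> x}"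
  proof (rule prime_dvd_card_moved[OF p])
    show "finite C" using finS by (simp add: C_def)
    show "u \<otimes> x \<in> C" if "x \<in> C" for x
    proof -
      have x: "x \<in> carrier G" "x [^] p = \<one>" "u \<otimes> x = x \<otimes> u" using that by (auto simp: C_def S_def)
      have "(u \<otimes> x) [^] p = \<one>" using pow_mult_distrib[OF x(3) u x(1)] x(2) up by simp
      moreover have "u \<otimes> (u \<otimes> x) = u \<otimes> x \<otimes> u" using x u by (metis m_assoc)
      ultimately show ?thesis using x u by (simp add: C_def S_def)
    qed
    show "(((\<otimes>) u) ^^ p) x = x" if "x \<in> C" for x
    proof -
      have x: "x \<in> carrier G" using that by (simp add: C_def S_def)
      have "(((\<otimes>) u) ^^ k) x = u [^] k \<otimes> x" for k
        by (induction k) (use u x nat_pow_Suc2[OF u] in \<open>simp_all add: m_assoc\<close>)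
      then show ?thesis using up x by simp
    qed
  qed
  moreover have "{x \<in> C. u \<otimes> x \<noteq> x} = C"
    using u u1 by (auto simp: C_def S_def)
  ultimately have "p dvd card (S - C) + card C" by (metis dvd_add)
  also have "card (S - C) + card C = card (S - C \<union> C)"
    using finS by (intro card_Un_disjoint[symmetric]) (auto simp: C_def)
  also have "S - C \<union> C = S" by (auto simp: C_def)
  finally show ?thesis unfolding S_def .
qed

text \<open>
  The only solution of \<open>x\<^sup>p = \<one>\<close> whose order is not \<open>p\<close> is \<open>\<one>\<close>.
\<close>

lemma prime_dvd_Suc_card_ord:
  assumes fin: "finite (carrier G)" and p: "prime p" and "p dvd order G"
  shows "p dvd Suc (card {x \<in> carrier G. ord x = p})"
proof -
  have "x [^] p = \<one> \<longleftrightarrow> x = \<one> \<or> ord x = p" if x: "x \<in> carrier G" for x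
  proof -
    have "x [^] p = \<one> \<longleftrightarrow> ord x dvd p" by (rule pow_eq_id[OF x])
    also have "\<dots> \<longleftrightarrow> ord x = 1 \<or> ord x = p" using p by (auto simp: prime_nat_iff)
    finally show ?thesis using ord_eq_1[OF x] by blast
  qed
  then have "{x \<in> carrier G. x [^] p = \<one>} = insert \<one> {x \<in> carrier G. ord x = p}" by auto
  moreover have "\<one> \<notin> {x \<in> carrier G. ord x = p}" using p by auto
  ultimately show ?thesis
    using prime_dvd_card_roots_of_one[OF assms] fin by simp
qed

end

section \<open>Products that are not order sequences\<close>

lemma count_seq_prod_order_seq_prime:
  assumes "group G" "finite (carrier G)" "group H" "finite (carrier H)" and p: "prime p"
  shows "count (mset (seq_prod (order_seq G) (order_seq H))) p =
    count (mset (order_seq G)) p + count (mset (order_seq H)) p"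
proof -
  interpret G: group G by fact
  interpret H: group H by fact
  let ?A = "{x \<in> carrier G. G.ord x = p} \<times> {\<one>\<^bsub>H\<^esub>}"
  let ?B = "{\<one>\<^bsub>G\<^esub>} \<times> {y \<in> carrier H. H.ord y = p}"
  have "{z \<in> carrier G \<times> carrier H. (case z of (x, y) \<Rightarrow> G.ord x * H.ord y) = p} = ?A \<union> ?B"
  proof -
    have "G.ord x * H.ord y = p \<longleftrightarrow> G.ord x = p \<and> y = \<one>\<^bsub>H\<^esub> \<or> x = \<one>\<^bsub>G\<^esub> \<and> H.ord y = p"
      if "x \<in> carrier G" "y \<in> carrier H" for x y
    proof -
      have "G.ord x * H.ord y = p \<longleftrightarrow> G.ord x = p \<and> H.ord y = 1 \<or> G.ord x = 1 \<and> H.ord y = p"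
        using p prime_product[of "G.ord x" "H.ord y"] by auto
      then show ?thesis using that G.ord_eq_1 H.ord_eq_1 by simp
    qed
    then show ?thesis by auto
  qed
  moreover have "card (?A \<union> ?B) = card ?A + card ?B"
    using assms p by (intro card_Un_disjoint) auto
  moreover have "count (mset (seq_prod (order_seq G) (order_seq H))) p
    = card {z \<in> carrier G \<times> carrier H. (case z of (x, y) \<Rightarrow> G.ord x * H.ord y) = p}"
    unfolding seq_prod_def mset_sort mset_map_product_order_seq[OF assms(2,4)] using assms(2,4)
    by (simp add: count_image_mset_set)
  ultimately show ?thesis
    using assms by (simp add: count_order_seq card_cartesian_product)
qed

text \<open>
  The number of entries \<open>p\<close> would have to be both \<open>-1\<close> and \<open>(-1) + (-1)\<close> modulo a common prime
  divisor \<open>p\<close> of the group orders.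
\<close>

lemma seq_prod_not_order_seq:
  assumes G: "group G" "finite (carrier G)" and H: "group H" "finite (carrier H)"
    and K: "group K" "finite (carrier K)"
    and not_coprime: "\<not> coprime (order G) (order H)"
  shows "seq_prod (order_seq G) (order_seq H) \<noteq> order_seq K"
proof
  assume eq: "seq_prod (order_seq G) (order_seq H) = order_seq K"
  obtain p where p: "prime p" and pG: "p dvd order G" and pH: "p dvd order H"
  proof -
    have "gcd (order G) (order H) \<noteq> 1" using not_coprime coprime_iff_gcd_eq_1 by blast
    then obtain p where "prime p" "p dvd gcd (order G) (order H)" using prime_factor_nat by blast
    then show ?thesis using that by simp
  qed
  have "order K = order G * order H"
    using arg_cong[OF eq, of length] by (simp add: seq_prod_def length_order_seq)
  then have pK: "p dvd order K" using pG by simp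
  let ?c = "\<lambda>xs. count (mset xs) p"
  have "p dvd Suc (?c (order_seq G))" "p dvd Suc (?c (order_seq H))" "p dvd Suc (?c (order_seq K))"
    using group.prime_dvd_Suc_card_ord[OF G p pG] group.prime_dvd_Suc_card_ord[OF H p pH]
      group.prime_dvd_Suc_card_ord[OF K p pK] G H K by (simp_all add: count_order_seq)
  moreover have "?c (order_seq K) = ?c (order_seq G) + ?c (order_seq H)"
    using count_seq_prod_order_seq_prime[OF G H p] eq by simp
  then have "Suc (?c (order_seq G)) + Suc (?c (order_seq H)) = Suc (?c (order_seq K)) + 1" by simp
  ultimately have "p dvd 1" by (metis dvd_add dvd_add_right_iff)
  then show False using p not_prime_unit by blast
qed

theorem theorem2p4:
  fixes G :: "('a, 'm) monoid_scheme" and H :: "('b, 'n) monoid_scheme"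
  assumes "group G" and "finite (carrier G)"
    and "group H" and "finite (carrier H)"
  shows
    "(order_seq (G \<times>\<times> H) = seq_lcm (order_seq G) (order_seq H) \<and>
      (order_seq (G \<times>\<times> H) = seq_prod (order_seq G) (order_seq H)
        \<longleftrightarrow> coprime (order G) (order H))) \<and>
     (coprime (order G) (order H) \<longrightarrow>
       (\<forall>(G' :: ('c, 'p) monoid_scheme) (H' :: ('d, 'q) monoid_scheme).
          group G' \<and> finite (carrier G') \<and> group H' \<and> finite (carrier H') \<and>
          order G' = order G \<and> order H' = order H \<and>
          order_seq (G' \<times>\<times> H') = order_seq (G \<times>\<times> H)
          \<longrightarrow> order_seq G' = order_seq G \<and> order_seq H' = order_seq H)) \<and>
     (\<not> coprime (order G) (order H) \<longrightarrow>
       \<not> (\<exists>K :: ('e, 'r) monoid_scheme. group K \<and> finite (carrier K) \<and>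
            seq_prod (order_seq G) (order_seq H) = order_seq K))"
proof (intro conjI)
  note not_order_seq = seq_prod_not_order_seq[OF assms]
  show "order_seq (G \<times>\<times> H) = seq_lcm (order_seq G) (order_seq H)"
    by (rule order_seq_DirProd[OF assms])
  have GH: "group (G \<times>\<times> H)" "finite (carrier (G \<times>\<times> H))"
    using DirProd_group[OF assms(1,3)] assms(2,4) by simp_all
  show "order_seq (G \<times>\<times> H) = seq_prod (order_seq G) (order_seq H)
      \<longleftrightarrow> coprime (order G) (order H)"
  proof
    assume "order_seq (G \<times>\<times> H) = seq_prod (order_seq G) (order_seq H)"
    then show "coprime (order G) (order H)" using not_order_seq[OF GH] by argo
  next
    assume "coprime (order G) (order H)"
    then show "order_seq (G \<times>\<times> H) = seq_prod (order_seq G) (order_seq H)"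
      by (rule order_seq_DirProd_coprime[OF assms])
  qed
  show "coprime (order G) (order H) \<longrightarrow>
       (\<forall>(G' :: ('c, 'p) monoid_scheme) (H' :: ('d, 'q) monoid_scheme).
          group G' \<and> finite (carrier G') \<and> group H' \<and> finite (carrier H') \<and>
          order G' = order G \<and> order H' = order H \<and>
          order_seq (G' \<times>\<times> H') = order_seq (G \<times>\<times> H)
          \<longrightarrow> order_seq G' = order_seq G \<and> order_seq H' = order_seq H)"
    by (intro impI allI conjI; elim conjE) (rule order_seq_factors_determined[OF assms]; assumption)+
  show "\<not> coprime (order G) (order H) \<longrightarrow>
       \<not> (\<exists>K :: ('e, 'r) monoid_scheme. group K \<and> finite (carrier K) \<and>
            seq_prod (order_seq G) (order_seq H) = order_seq K)"
  proof (intro impI notI, elim exE conjE)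
    fix K :: "('e, 'r) monoid_scheme"
    assume "\<not> coprime (order G) (order H)" "group K" "finite (carrier K)"
      and "seq_prod (order_seq G) (order_seq H) = order_seq K"
    then show False using not_order_seq[of K] by argo
  qed
qed

end
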